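(* Let $\mathcal{L}$ be a fragment of hybrid-dynamic quantum logic (HDQL) as described in the context. Assume that the signatures of $\mathcal{L}$ have no closed propositional symbols and that the actions of $\mathcal{L}$ are free of the operator $*$. Then the least entailment system of $\mathcal{L}$ closed under the basic proof rules, the necessity rules and the implication rules is compact; that is, for all signatures $\Delta$ of $\mathcal{L}$, all sets $\Gamma$ of $\Delta$-sentences, all $\Delta$-sentences $\gamma$ and all ground terms $k$ of sort vector, $\Gamma\vdash^k_\Delta\gamma$ implies $\Gamma_f\vdash^k_\Delta\gamma$ for some finite $\Gamma_f\subseteq\Gamma$.
   Context: **Hilbert spaces.** $\Sigma^{h}=(S^{h},F^{h},P^{h})$ is the two-sorted first-order signature with sorts $\mathsf{c}$ (scalars) and $\mathsf{v}$ (vectors), function symbols $F^{h}=F^{\mathsf{c}}\cup F^{\mathsf{v}}$, where $F^{\mathsf{c}}$ is a fixed set of the usual operations on complex numbers (addition, multiplication, etc.) and $F^{\mathsf{v}}$ consists of vector addition, the zero vector $0$, scalar multiplication and inner product $\langle\_\mid\_\rangle:\mathsf{v}\,\mathsf{v}\to\mathsf{c}$, and a single relation symbol $<$ on $\mathsf{c}$. A Hilbert space is a $\Sigma^{h}$-structure $\mathcal{H}$ with $\mathcal{H}_{\mathsf{c}}=\mathbb{C}$, $F^{\mathsf{c}}$ interpreted as usual, $<$ the usual strict order on real numbers, and $\mathcal{H}_{\mathsf{v}}$ with $F^{\mathsf{v}}$ a complete complex inner product space. **Signatures.** An HDQL signature is $\Delta=(\Sigma,E,\mathrm{Prop})$ where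 $\Sigma$ is $\Sigma^{h}$ extended with a set $U$ of unitary transformation symbols $u:\mathsf{v}\to\mathsf{v}$, a set $Q$ of projective measurement symbols $q:\mathsf{v}\to\mathsf{v}$, a set $D$ of constants of sort $\mathsf{v}$ and a set $C$ of constants of sort $\mathsf{c}$; $E$ is a set of first-order $\Sigma$-sentences; $\mathrm{Prop}$ is a set of propositional symbols with a distinguished subset $\mathrm{Prop}_c$ of closed propositional symbols. A signature morphism $\chi:\Delta_1\to\Delta_2$ consists of a first-order signature morphism $\chi:\Sigma_1\to\Sigma_2$ with $E_2\models\chi(E_1)$ that is the identity on $\Sigma^{h}$ and satisfies $\chi(U_1)\subseteq U_2$, $\chi(Q_1)\subseteq Q_2$, together with a map $\chi:\mathrm{Prop}_1\to\mathrm{Prop}_2$ sending closed propositional symbols to closed propositional symbols. It induces a symbol-wise translation of terms and sentences, also written $\chi$. **Sentences.** Actions: $\mathfrak{a}::=u\mid q\mid \mathfrak{a};\mathfrak{a}\mid\mathfrak{a}\cup\mathfrak{a}\mid\mathfrak{a}^*$ ($u\in U$, $q\in Q$). Sentences: $\gamma::=p\mid @_k\gamma\mid\gamma\wedge\gamma\mid\neg\gamma\mid\;\sim\gamma\mid[\mathfrak{a}]\gamma\mid{\downarrow}z\cdot\gamma$, where $p\in\mathrm{Prop}$, $k$ is a term of sort $\mathsf{v}$, $\mathfrak{a}$ is an action, $z$ is a variable of sort $\mathsf{v}$ (which may be used as an additional vector constant inside $\gamma$ in ${\downarrow}z\cdot\gamma$). Classical implication is written $\varphi\Rightarrow\gamma$.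 Closed sentences: $\rho::=r\mid\;\sim\rho\mid\rho\wedge\rho\mid[\mathfrak{b}]\rho$, with $r\in\mathrm{Prop}_c$ and $\mathfrak{b}$ an action containing no measurement symbol. For closed sentences, quantum implication (Sasaki hook) is $\rho_1\leadsto\rho_2:=\;\sim(\rho_1\wedge\sim(\rho_1\wedge\rho_2))$. **Basic sentences and quantum clauses.** Basic sentences: $\varphi::=p\mid\varphi\wedge\varphi\mid @_k\varphi\mid[\mathfrak{a}]\varphi\mid{\downarrow}z\cdot\varphi$. Quantum clauses: $\gamma::=p\mid\rho_1\leadsto\rho_2\mid\varphi\Rightarrow\gamma\mid\gamma\wedge\gamma\mid @_k\gamma\mid[\mathfrak{a}]\gamma\mid{\downarrow}z\cdot\gamma$, where $\rho_1$ is a closed sentence that is basic, $\rho_2$ is a closed sentence that is a quantum clause, and $\varphi$ is basic. **The fragment $\mathcal{L}$.** Let $\Sigma$ be $\Sigma^{h}$ extended only with sets $U,Q$, and let $\mathcal{W}$ be a $\Sigma$-structure whose $\Sigma^{h}$-reduct is a Hilbert space, with each $u^{\mathcal{W}}$ a unitary operator and each $q^{\mathcal{W}}$ a projective measurement, i.e. there is a closed subspace $\mathcal{X}\subseteq\mathcal{W}_{\mathsf{v}}$ with orthogonal projection $P_{\mathcal{X}}$ such that $q^{\mathcal{W}}(w)=P_{\mathcal{X}}(w)/\sqrt{\langle w\mid P_{\mathcal{X}}(w)\rangle}$ for all $w$ (read as $0$ if $P_{\mathcal{X}}(w)=0$). $\Sigma_{\mathcal{W}}$ is $\Sigma$ with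 all vectors of $\mathcal{W}$ added as constants of sort $\mathsf{v}$ and all complex numbers added as constants of sort $\mathsf{c}$; $\mathcal{W}_{\mathcal{W}}$ is the expansion of $\mathcal{W}$ interpreting each such constant as itself; $E_{\mathcal{W}}$ is the set of ground equations and ground relational atoms over $\Sigma_{\mathcal{W}}$ true in $\mathcal{W}_{\mathcal{W}}$. $\mathcal{L}$ is an arbitrary fragment of HDQL (obtained by restricting signatures and possibly discarding some sentence or action operators, including $\Rightarrow$ and $\leadsto$, which are treated as operators) such that all its signatures have the form $\Delta_{\mathcal{W}}=(\Sigma_{\mathcal{W}},E_{\mathcal{W}},\mathrm{Prop})$, and retrieve $@$ belongs to $\mathcal{L}$ whenever $\Rightarrow$ or $\leadsto$ does. Signature morphisms of $\mathcal{L}$ are the identity on complex numbers. **Entailment systems.** An entailment system of $\mathcal{L}$ is a family of relations $\vdash^k_\Delta$ between sets of $\Delta$-sentences and $\Delta$-sentences (for $\Delta$ a signature of $\mathcal{L}$ and $k$ a ground term of sort $\mathsf{v}$) satisfying: (Monotonicity) $\Gamma\vdash^k\gamma$ if $\gamma\in\Gamma$; (Unions) $\Gamma\vdash^k\gamma$ implies $\Gamma\cup\Gamma'\vdash^k\gamma$; (Translation) $\Gamma\vdash^k\gamma$ implies $\chi(\Gamma)\vdash^{\chi(k)}\chi(\gamma)$ for each signature morphism $\chi$ of $\mathcal{L}$. No cut rule is assumed. **Proof rules** (over a signature $\Delta_{\mathcal{W}}$; for sentences of $\mathcal{L}$). *Basic rules*: from $\Gamma\vdash^{k_1}\gamma$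 infer $\Gamma\vdash^{k_2}\gamma$ for each equation $k_1=k_2$ in $E_{\mathcal{W}}$; $\Gamma\vdash^{k_1}\gamma$ and $\Gamma\vdash^{k_2}@_{k_1}\gamma$ are inferable from each other; $\Gamma\vdash^k\gamma[z\leftarrow k]$ (substitute $k$ for $z$) and $\Gamma\vdash^k{\downarrow}z\cdot\gamma$ are inferable from each other; from $\Gamma\vdash^k\gamma_1$ and $\Gamma\vdash^k\gamma_2$ infer $\Gamma\vdash^k\gamma_1\wedge\gamma_2$; from $\Gamma\vdash^k\gamma_1\wedge\gamma_2$ infer $\Gamma\vdash^k\gamma_i$ ($i=1,2$). *Necessity rules* (the rules for $*$ do not apply, since actions are $*$-free): for $f\in U\cup Q$, $\Gamma\vdash^{f(k)}\gamma$ and $\Gamma\vdash^k[f]\gamma$ are inferable from each other; $\Gamma\vdash^k[\mathfrak{a}_1;\mathfrak{a}_2]\gamma$ and $\Gamma\vdash^k[\mathfrak{a}_1][\mathfrak{a}_2]\gamma$ are inferable from each other; from $\Gamma\vdash^k[\mathfrak{a}_1]\gamma$ and $\Gamma\vdash^k[\mathfrak{a}_2]\gamma$ infer $\Gamma\vdash^k[\mathfrak{a}_1\cup\mathfrak{a}_2]\gamma$; from $\Gamma\vdash^k[\mathfrak{a}_1\cup\mathfrak{a}_2]\gamma$ infer $\Gamma\vdash^k[\mathfrak{a}_i]\gamma$ ($i=1,2$). *Implication rules* ($\varphi$ basic, $\rho_1$ closed basic, $\rho_2$ closed quantum clause): from $\Gamma\vdash^k\varphi\Rightarrow\gamma$ and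 $\Gamma\vdash^k\varphi$ infer $\Gamma\vdash^k\gamma$; from $\Gamma\vdash^k\rho_1\leadsto\rho_2$ and $\Gamma\vdash^k\rho_1$ infer $\Gamma\vdash^k\rho_2$; from $\Gamma\cup\{@_k\varphi\}\vdash^k\gamma$ infer $\Gamma\vdash^k\varphi\Rightarrow\gamma$; from $\Gamma\cup\{@_k\rho_1\}\vdash^k\rho_2$ infer $\Gamma\vdash^k\rho_1\leadsto\rho_2$. *)

theory Defs
  imports "HOL-Analysis.Analysis"
begin

section \<open>Terms\<close>

text \<open>
  The fixed set of operation symbols on complex numbers consists of addition, multiplication and the
  elements of a type of class \<open>scalar_ops\<close>.  The class leaves the choice of the further usual operations
  (constants, subtraction, conjugation, square root, ...) and their interpretation open, so everything
  below holds for any such choice.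
\<close>

class scalar_ops =
  fixes scalar_arity :: "'a \<Rightarrow> nat"
    and scalar_op :: "'a \<Rightarrow> complex list \<Rightarrow> complex"

text \<open>
  Constants of sort vector: the symbol \<open>0\<close> of the signature of Hilbert spaces, and the added constants.
  The vector \<open>0\<close> of a Hilbert space, added as a constant, is a different symbol.
\<close>

datatype 'v vconst = Zero | Name 'v

datatype ('f, 'v, 'u, 'q) sterm =
    SConst complex
  | SPlus "('f, 'v, 'u, 'q) sterm" "('f, 'v, 'u, 'q) sterm"
  | STimes "('f, 'v, 'u, 'q) sterm" "('f, 'v, 'u, 'q) sterm"
  | SOp 'f "('f, 'v, 'u, 'q) sterm list"
  | SInner "('f, 'v, 'u, 'q) vterm" "('f, 'v, 'u, 'q) vterm"
and ('f, 'v, 'u, 'q) vterm =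
    VConst "'v vconst"
  | VVar nat
  | VPlus "('f, 'v, 'u, 'q) vterm" "('f, 'v, 'u, 'q) vterm"
  | VScale "('f, 'v, 'u, 'q) sterm" "('f, 'v, 'u, 'q) vterm"
  | VUnit 'u "('f, 'v, 'u, 'q) vterm"
  | VMeas 'q "('f, 'v, 'u, 'q) vterm"

text \<open>
  Ground equations (of either sort) and ground relational atoms; the signatures of the fragments considered
  have no other axioms.
\<close>

datatype ('f, 'v, 'u, 'q) atom =
    EqS "('f, 'v, 'u, 'q) sterm" "('f, 'v, 'u, 'q) sterm"
  | EqV "('f, 'v, 'u, 'q) vterm" "('f, 'v, 'u, 'q) vterm"
  | LessS "('f, 'v, 'u, 'q) sterm" "('f, 'v, 'u, 'q) sterm"

text \<open>A first-order signature extending that of Hilbert spaces is given by the symbols that it adds.\<close>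

record ('v, 'u, 'q) fo_sig =
  unitaries :: "'u set"
  measurements :: "'q set"
  vconsts :: "'v set"
  sconsts :: "complex set"

record ('f, 'v, 'u, 'q, 'p) hdql_sig = "('v, 'u, 'q) fo_sig" +
  axms :: "('f, 'v, 'u, 'q) atom set"
  props :: "'p set"
  closed_props :: "'p set"

text \<open>Terms over a signature whose variables lie in \<open>X\<close>.\<close>

fun sterm_over :: "('v, 'u, 'q, 'z) fo_sig_scheme \<Rightarrow> nat set \<Rightarrow> ('f::scalar_ops, 'v, 'u, 'q) sterm \<Rightarrow> bool"
  and vterm_over :: "('v, 'u, 'q, 'z) fo_sig_scheme \<Rightarrow> nat set \<Rightarrow> ('f::scalar_ops, 'v, 'u, 'q) vterm \<Rightarrow> bool"
where
  "sterm_over S X (SConst c) \<longleftrightarrow> c \<in> sconsts S"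
| "sterm_over S X (SPlus s t) \<longleftrightarrow> sterm_over S X s \<and> sterm_over S X t"
| "sterm_over S X (STimes s t) \<longleftrightarrow> sterm_over S X s \<and> sterm_over S X t"
| "sterm_over S X (SOp f ts) \<longleftrightarrow> length ts = scalar_arity f \<and> (\<forall>t\<in>set ts. sterm_over S X t)"
| "sterm_over S X (SInner k l) \<longleftrightarrow> vterm_over S X k \<and> vterm_over S X l"
| "vterm_over S X (VConst d) \<longleftrightarrow> d \<in> insert Zero (Name ` vconsts S)"
| "vterm_over S X (VVar z) \<longleftrightarrow> z \<in> X"
| "vterm_over S X (VPlus k l) \<longleftrightarrow> vterm_over S X k \<and> vterm_over S X l"
| "vterm_over S X (VScale s k) \<longleftrightarrow> sterm_over S X s \<and> vterm_over S X k"
| "vterm_over S X (VUnit u k) \<longleftrightarrow> u \<in> unitaries S \<and> vterm_over S X k"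
| "vterm_over S X (VMeas q k) \<longleftrightarrow> q \<in> measurements S \<and> vterm_over S X k"

abbreviation ground_vterm :: "('v, 'u, 'q, 'z) fo_sig_scheme \<Rightarrow> ('f::scalar_ops, 'v, 'u, 'q) vterm \<Rightarrow> bool"
  where "ground_vterm S \<equiv> vterm_over S {}"

fun ground_atom :: "('v, 'u, 'q, 'z) fo_sig_scheme \<Rightarrow> ('f::scalar_ops, 'v, 'u, 'q) atom \<Rightarrow> bool"
where
  "ground_atom S (EqS s t) \<longleftrightarrow> sterm_over S {} s \<and> sterm_over S {} t"
| "ground_atom S (EqV k l) \<longleftrightarrow> vterm_over S {} k \<and> vterm_over S {} l"
| "ground_atom S (LessS s t) \<longleftrightarrow> sterm_over S {} s \<and> sterm_over S {} t"

section \<open>First-order structures\<close>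

text \<open>
  Structures interpret all symbols of the types involved; only the symbols of the signature at hand matter.
  The first record does not interpret the added constants.
\<close>

record ('s, 'w, 'f, 'u, 'q) str =
  scalars :: "'s set"
  vectors :: "'w set"
  splus :: "'s \<Rightarrow> 's \<Rightarrow> 's"
  stimes :: "'s \<Rightarrow> 's \<Rightarrow> 's"
  sop :: "'f \<Rightarrow> 's list \<Rightarrow> 's"
  sless :: "'s \<Rightarrow> 's \<Rightarrow> bool"
  vzero :: "'w"
  vplus :: "'w \<Rightarrow> 'w \<Rightarrow> 'w"
  vscale :: "'s \<Rightarrow> 'w \<Rightarrow> 'w"
  ip :: "'w \<Rightarrow> 'w \<Rightarrow> 's"
  unitary_op :: "'u \<Rightarrow> 'w \<Rightarrow> 'w"
  meas_op :: "'q \<Rightarrow> 'w \<Rightarrow> 'w"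

record ('s, 'w, 'f, 'u, 'q, 'v) cstr = "('s, 'w, 'f, 'u, 'q) str" +
  sname :: "complex \<Rightarrow> 's"
  vname :: "'v \<Rightarrow> 'w"

definition fo_structure ::
  "('v, 'u, 'q, 'z) fo_sig_scheme \<Rightarrow> ('s, 'w, 'f::scalar_ops, 'u, 'q, 'v) cstr \<Rightarrow> bool"
where
  "fo_structure S M \<longleftrightarrow>
     (\<forall>a\<in>scalars M. \<forall>b\<in>scalars M. splus M a b \<in> scalars M \<and> stimes M a b \<in> scalars M) \<and>
     (\<forall>f as. set as \<subseteq> scalars M \<and> length as = scalar_arity f \<longrightarrow> sop M f as \<in> scalars M) \<and>
     vzero M \<in> vectors M \<and>
     (\<forall>x\<in>vectors M. \<forall>y\<in>vectors M. vplus M x y \<in> vectors M \<and> ip M x y \<in> scalars M) \<and>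
     (\<forall>a\<in>scalars M. \<forall>x\<in>vectors M. vscale M a x \<in> vectors M) \<and>
     (\<forall>u\<in>unitaries S. \<forall>x\<in>vectors M. unitary_op M u x \<in> vectors M) \<and>
     (\<forall>q\<in>measurements S. \<forall>x\<in>vectors M. meas_op M q x \<in> vectors M) \<and>
     (\<forall>c\<in>sconsts S. sname M c \<in> scalars M) \<and>
     (\<forall>d\<in>vconsts S. vname M d \<in> vectors M)"

text \<open>Only ground terms are evaluated; the value of a variable is irrelevant.\<close>

fun seval :: "('s, 'w, 'f, 'u, 'q, 'v) cstr \<Rightarrow> ('f, 'v, 'u, 'q) sterm \<Rightarrow> 's"
  and veval :: "('s, 'w, 'f, 'u, 'q, 'v) cstr \<Rightarrow> ('f, 'v, 'u, 'q) vterm \<Rightarrow> 'w"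
where
  "seval M (SConst c) = sname M c"
| "seval M (SPlus s t) = splus M (seval M s) (seval M t)"
| "seval M (STimes s t) = stimes M (seval M s) (seval M t)"
| "seval M (SOp f ts) = sop M f (map (seval M) ts)"
| "seval M (SInner k l) = ip M (veval M k) (veval M l)"
| "veval M (VConst d) = (case d of Zero \<Rightarrow> vzero M | Name v \<Rightarrow> vname M v)"
| "veval M (VVar z) = undefined"
| "veval M (VPlus k l) = vplus M (veval M k) (veval M l)"
| "veval M (VScale s k) = vscale M (seval M s) (veval M k)"
| "veval M (VUnit u k) = unitary_op M u (veval M k)"
| "veval M (VMeas q k) = meas_op M q (veval M k)"

fun holds :: "('s, 'w, 'f, 'u, 'q, 'v) cstr \<Rightarrow> ('f, 'v, 'u, 'q) atom \<Rightarrow> bool"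
where
  "holds M (EqS s t) \<longleftrightarrow> seval M s = seval M t"
| "holds M (EqV k l) \<longleftrightarrow> veval M k = veval M l"
| "holds M (LessS s t) \<longleftrightarrow> sless M (seval M s) (seval M t)"

text \<open>
  Semantic consequence.  HOL needs a fixed universe for the carriers of the structures; the terms
  are large enough: if a structure of any size satisfies \<open>A\<close> but not \<open>a\<close>, then so does its substructure
  generated by the ground terms, and choosing a term for each element gives an isomorphic copy among
  the structures considered here.
\<close>

definition fo_entails ::
  "('v, 'u, 'q, 'z) fo_sig_scheme \<Rightarrow> ('f::scalar_ops, 'v, 'u, 'q) atom set \<Rightarrow> ('f, 'v, 'u, 'q) atom \<Rightarrow> bool"
where
  "fo_entails S A a \<longleftrightarrow>
     (\<forall>M :: (('f, 'v, 'u, 'q) sterm, ('f, 'v, 'u, 'q) vterm, 'f, 'u, 'q, 'v) cstr.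
        fo_structure S M \<and> (\<forall>b\<in>A. holds M b) \<longrightarrow> holds M a)"

section \<open>Hilbert spaces, unitary operators and projective measurements\<close>

definition complex_inner_product_space :: "(complex, 'w, 'f, 'u, 'q) str \<Rightarrow> bool"
where
  "complex_inner_product_space W \<longleftrightarrow>
     vzero W \<in> vectors W \<and>
     (\<forall>x\<in>vectors W. \<forall>y\<in>vectors W. vplus W x y \<in> vectors W) \<and>
     (\<forall>a. \<forall>x\<in>vectors W. vscale W a x \<in> vectors W) \<and>
     (\<forall>x\<in>vectors W. \<forall>y\<in>vectors W. \<forall>z\<in>vectors W.
        vplus W (vplus W x y) z = vplus W x (vplus W y z)) \<and>
     (\<forall>x\<in>vectors W. \<forall>y\<in>vectors W. vplus W x y = vplus W y x) \<and>
     (\<forall>x\<in>vectors W. vplus W (vzero W) x = x) \<and>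
     (\<forall>x\<in>vectors W. \<exists>y\<in>vectors W. vplus W x y = vzero W) \<and>
     (\<forall>a. \<forall>x\<in>vectors W. \<forall>y\<in>vectors W.
        vscale W a (vplus W x y) = vplus W (vscale W a x) (vscale W a y)) \<and>
     (\<forall>a b. \<forall>x\<in>vectors W. vscale W (a + b) x = vplus W (vscale W a x) (vscale W b x)) \<and>
     (\<forall>a b. \<forall>x\<in>vectors W. vscale W (a * b) x = vscale W a (vscale W b x)) \<and>
     (\<forall>x\<in>vectors W. vscale W 1 x = x) \<and>
     (\<forall>x\<in>vectors W. \<forall>y\<in>vectors W. ip W x y = cnj (ip W y x)) \<and>
     (\<forall>x\<in>vectors W. \<forall>y\<in>vectors W. \<forall>z\<in>vectors W.
        ip W x (vplus W y z) = ip W x y + ip W x z) \<and>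
     (\<forall>a. \<forall>x\<in>vectors W. \<forall>y\<in>vectors W. ip W x (vscale W a y) = a * ip W x y) \<and>
     (\<forall>x\<in>vectors W. ip W x x \<in> \<real> \<and> 0 \<le> Re (ip W x x)) \<and>
     (\<forall>x\<in>vectors W. ip W x x = 0 \<longrightarrow> x = vzero W)"

definition vdiff :: "(complex, 'w, 'f, 'u, 'q) str \<Rightarrow> 'w \<Rightarrow> 'w \<Rightarrow> 'w"
  where "vdiff W x y = vplus W x (vscale W (-1) y)"

text \<open>
  The locale \<^locale>\<open>Metric_space\<close> asks for nonnegativity and symmetry on the whole type, hence the
  value \<open>0\<close> outside the carrier.
\<close>

definition vdist :: "(complex, 'w, 'f, 'u, 'q) str \<Rightarrow> 'w \<Rightarrow> 'w \<Rightarrow> real"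
where
  "vdist W x y =
     (if x \<in> vectors W \<and> y \<in> vectors W then sqrt (Re (ip W (vdiff W x y) (vdiff W x y))) else 0)"

text \<open>In \<open>hilbert_space W\<close>, \<open>sless\<close> is the order of the reals, so nonreal numbers are unrelated.\<close>

definition hilbert_space :: "(complex, 'w, 'f::scalar_ops, 'u, 'q) str \<Rightarrow> bool"
where
  "hilbert_space W \<longleftrightarrow>
     scalars W = UNIV \<and> splus W = (+) \<and> stimes W = (*) \<and>
     (\<forall>f as. length as = scalar_arity f \<longrightarrow> sop W f as = scalar_op f as) \<and>
     (\<forall>a b. sless W a b \<longleftrightarrow> a \<in> \<real> \<and> b \<in> \<real> \<and> Re a < Re b) \<and>
     complex_inner_product_space W \<and>
     Metric_space.mcomplete (vectors W) (vdist W)"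

definition unitary_on :: "(complex, 'w, 'f, 'u, 'q) str \<Rightarrow> ('w \<Rightarrow> 'w) \<Rightarrow> bool"
where
  "unitary_on W g \<longleftrightarrow>
     bij_betw g (vectors W) (vectors W) \<and>
     (\<forall>x\<in>vectors W. \<forall>y\<in>vectors W. g (vplus W x y) = vplus W (g x) (g y)) \<and>
     (\<forall>a. \<forall>x\<in>vectors W. g (vscale W a x) = vscale W a (g x)) \<and>
     (\<forall>x\<in>vectors W. \<forall>y\<in>vectors W. ip W (g x) (g y) = ip W x y)"

definition closed_subspace :: "(complex, 'w, 'f, 'u, 'q) str \<Rightarrow> 'w set \<Rightarrow> bool"
where
  "closed_subspace W X \<longleftrightarrow>
     X \<subseteq> vectors W \<and> vzero W \<in> X \<and>
     (\<forall>x\<in>X. \<forall>y\<in>X. vplus W x y \<in> X) \<and> (\<forall>a. \<forall>x\<in>X. vscale W a x \<in> X) \<and>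
     closedin (Metric_space.mtopology (vectors W) (vdist W)) X"

definition orth_proj :: "(complex, 'w, 'f, 'u, 'q) str \<Rightarrow> 'w set \<Rightarrow> 'w \<Rightarrow> 'w"
  where "orth_proj W X w = (THE x. x \<in> X \<and> (\<forall>y\<in>X. ip W y (vdiff W w x) = 0))"

definition projective_measurement :: "(complex, 'w, 'f, 'u, 'q) str \<Rightarrow> ('w \<Rightarrow> 'w) \<Rightarrow> bool"
where
  "projective_measurement W g \<longleftrightarrow>
     (\<exists>X. closed_subspace W X \<and>
        (\<forall>w\<in>vectors W.
           g w = (if orth_proj W X w = vzero W then vzero W
                  else vscale W (1 / csqrt (ip W w (orth_proj W X w))) (orth_proj W X w))))"

definition quantum_structure ::
  "'u set \<Rightarrow> 'q set \<Rightarrow> (complex, 'w, 'f::scalar_ops, 'u, 'q) str \<Rightarrow> bool"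
where
  "quantum_structure U Q W \<longleftrightarrow>
     hilbert_space W \<and>
     (\<forall>u\<in>U. unitary_on W (unitary_op W u)) \<and>
     (\<forall>q\<in>Q. projective_measurement W (meas_op W q))"

text \<open>The expansion of \<open>W\<close> in which every vector and every complex number names itself.\<close>

definition self_named :: "(complex, 'v, 'f, 'u, 'q) str \<Rightarrow> (complex, 'v, 'f, 'u, 'q, 'v) cstr"
  where "self_named W = str.extend W \<lparr>sname = id, vname = id\<rparr>"

definition diagram_fo_sig :: "'u set \<Rightarrow> 'q set \<Rightarrow> (complex, 'v, 'f, 'u, 'q) str \<Rightarrow> ('v, 'u, 'q) fo_sig"
where
  "diagram_fo_sig U Q W =
     \<lparr>unitaries = U, measurements = Q, vconsts = vectors W, sconsts = UNIV\<rparr>"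

definition diagram_axms ::
  "'u set \<Rightarrow> 'q set \<Rightarrow> (complex, 'v, 'f::scalar_ops, 'u, 'q) str \<Rightarrow> ('f, 'v, 'u, 'q) atom set"
  where "diagram_axms U Q W = {a. ground_atom (diagram_fo_sig U Q W) a \<and> holds (self_named W) a}"

definition diagram_sig :: "('f::scalar_ops, 'v, 'u, 'q, 'p) hdql_sig \<Rightarrow> bool"
where
  "diagram_sig \<Delta> \<longleftrightarrow>
     closed_props \<Delta> \<subseteq> props \<Delta> \<and>
     (\<exists>W. quantum_structure (unitaries \<Delta>) (measurements \<Delta>) W \<and>
        fo_sig.truncate \<Delta> = diagram_fo_sig (unitaries \<Delta>) (measurements \<Delta>) W \<and>
        axms \<Delta> = diagram_axms (unitaries \<Delta>) (measurements \<Delta>) W)"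

section \<open>Sentences\<close>

datatype ('u, 'q) action =
    Unit 'u
  | Meas 'q
  | Seq "('u, 'q) action" "('u, 'q) action"
  | Choice "('u, 'q) action" "('u, 'q) action"
  | Star "('u, 'q) action"

text \<open>
  In order: \<open>p\<close>, \<open>@\<^sub>k \<gamma>\<close>, \<open>\<gamma> \<and> \<gamma>\<close>, \<open>\<not>\<gamma>\<close>, \<open>\<sim>\<gamma>\<close>, \<open>[\<aa>]\<gamma>\<close>, \<open>\<down>z \<cdot> \<gamma>\<close>, classical implication and
  quantum implication.  The two implications are operators in their own right, so that a fragment may
  contain them without containing negations.
\<close>

datatype ('f, 'v, 'u, 'q, 'p) sen =
    PropS 'p
  | AtS "('f, 'v, 'u, 'q) vterm" "('f, 'v, 'u, 'q, 'p) sen"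
  | AndS "('f, 'v, 'u, 'q, 'p) sen" "('f, 'v, 'u, 'q, 'p) sen"
  | NotS "('f, 'v, 'u, 'q, 'p) sen"
  | QNotS "('f, 'v, 'u, 'q, 'p) sen"
  | BoxS "('u, 'q) action" "('f, 'v, 'u, 'q, 'p) sen"
  | StoreS nat "('f, 'v, 'u, 'q, 'p) sen"
  | ImpS "('f, 'v, 'u, 'q, 'p) sen" "('f, 'v, 'u, 'q, 'p) sen"
  | QImpS "('f, 'v, 'u, 'q, 'p) sen" "('f, 'v, 'u, 'q, 'p) sen"

primrec meas_free :: "('u, 'q) action \<Rightarrow> bool"
where
  "meas_free (Unit u) \<longleftrightarrow> True"
| "meas_free (Meas q) \<longleftrightarrow> False"
| "meas_free (Seq a b) \<longleftrightarrow> meas_free a \<and> meas_free b"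
| "meas_free (Choice a b) \<longleftrightarrow> meas_free a \<and> meas_free b"
| "meas_free (Star a) \<longleftrightarrow> meas_free a"

text \<open>
  Closed sentences admit \<open>QImpS\<close>, since quantum implication abbreviates the closed sentence
  \<open>\<sim>(\<rho>\<^sub>1 \<and> \<sim>(\<rho>\<^sub>1 \<and> \<rho>\<^sub>2))\<close>.
\<close>

primrec closed_sen :: "('f, 'v, 'u, 'q, 'p) hdql_sig \<Rightarrow> ('f, 'v, 'u, 'q, 'p) sen \<Rightarrow> bool"
where
  "closed_sen \<Delta> (PropS p) \<longleftrightarrow> p \<in> closed_props \<Delta>"
| "closed_sen \<Delta> (AtS k \<gamma>) \<longleftrightarrow> False"
| "closed_sen \<Delta> (AndS \<gamma> \<delta>) \<longleftrightarrow> closed_sen \<Delta> \<gamma> \<and> closed_sen \<Delta> \<delta>"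
| "closed_sen \<Delta> (NotS \<gamma>) \<longleftrightarrow> False"
| "closed_sen \<Delta> (QNotS \<gamma>) \<longleftrightarrow> closed_sen \<Delta> \<gamma>"
| "closed_sen \<Delta> (BoxS a \<gamma>) \<longleftrightarrow> meas_free a \<and> closed_sen \<Delta> \<gamma>"
| "closed_sen \<Delta> (StoreS z \<gamma>) \<longleftrightarrow> False"
| "closed_sen \<Delta> (ImpS \<gamma> \<delta>) \<longleftrightarrow> False"
| "closed_sen \<Delta> (QImpS \<gamma> \<delta>) \<longleftrightarrow> closed_sen \<Delta> \<gamma> \<and> closed_sen \<Delta> \<delta>"

primrec basic :: "('f, 'v, 'u, 'q, 'p) sen \<Rightarrow> bool"
where
  "basic (PropS p) \<longleftrightarrow> True"
| "basic (AtS k \<gamma>) \<longleftrightarrow> basic \<gamma>"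
| "basic (AndS \<gamma> \<delta>) \<longleftrightarrow> basic \<gamma> \<and> basic \<delta>"
| "basic (NotS \<gamma>) \<longleftrightarrow> False"
| "basic (QNotS \<gamma>) \<longleftrightarrow> False"
| "basic (BoxS a \<gamma>) \<longleftrightarrow> basic \<gamma>"
| "basic (StoreS z \<gamma>) \<longleftrightarrow> basic \<gamma>"
| "basic (ImpS \<gamma> \<delta>) \<longleftrightarrow> False"
| "basic (QImpS \<gamma> \<delta>) \<longleftrightarrow> False"

primrec quantum_clause :: "('f, 'v, 'u, 'q, 'p) hdql_sig \<Rightarrow> ('f, 'v, 'u, 'q, 'p) sen \<Rightarrow> bool"
where
  "quantum_clause \<Delta> (PropS p) \<longleftrightarrow> True"
| "quantum_clause \<Delta> (AtS k \<gamma>) \<longleftrightarrow> quantum_clause \<Delta> \<gamma>"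
| "quantum_clause \<Delta> (AndS \<gamma> \<delta>) \<longleftrightarrow> quantum_clause \<Delta> \<gamma> \<and> quantum_clause \<Delta> \<delta>"
| "quantum_clause \<Delta> (NotS \<gamma>) \<longleftrightarrow> False"
| "quantum_clause \<Delta> (QNotS \<gamma>) \<longleftrightarrow> False"
| "quantum_clause \<Delta> (BoxS a \<gamma>) \<longleftrightarrow> quantum_clause \<Delta> \<gamma>"
| "quantum_clause \<Delta> (StoreS z \<gamma>) \<longleftrightarrow> quantum_clause \<Delta> \<gamma>"
| "quantum_clause \<Delta> (ImpS \<phi> \<gamma>) \<longleftrightarrow> basic \<phi> \<and> quantum_clause \<Delta> \<gamma>"
| "quantum_clause \<Delta> (QImpS \<rho>1 \<rho>2) \<longleftrightarrow>
     closed_sen \<Delta> \<rho>1 \<and> basic \<rho>1 \<and> closed_sen \<Delta> \<rho>2 \<and> quantum_clause \<Delta> \<rho>2"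

text \<open>The operators that a fragment may keep or discard.\<close>

datatype sen_operator = At_op | And_op | Not_op | QNot_op | Box_op | Store_op | Imp_op | QImp_op

datatype act_operator = Seq_op | Choice_op | Star_op

primrec action_over :: "act_operator set \<Rightarrow> ('v, 'u, 'q, 'z) fo_sig_scheme \<Rightarrow> ('u, 'q) action \<Rightarrow> bool"
where
  "action_over B S (Unit u) \<longleftrightarrow> u \<in> unitaries S"
| "action_over B S (Meas q) \<longleftrightarrow> q \<in> measurements S"
| "action_over B S (Seq a b) \<longleftrightarrow> Seq_op \<in> B \<and> action_over B S a \<and> action_over B S b"
| "action_over B S (Choice a b) \<longleftrightarrow> Choice_op \<in> B \<and> action_over B S a \<and> action_over B S b"
| "action_over B S (Star a) \<longleftrightarrow> Star_op \<in> B \<and> action_over B S a"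

text \<open>Sentences built with the operators in \<open>A\<close> and \<open>B\<close> whose free variables lie in \<open>X\<close>.\<close>

primrec sen_over ::
  "sen_operator set \<Rightarrow> act_operator set \<Rightarrow> ('f::scalar_ops, 'v, 'u, 'q, 'p) hdql_sig \<Rightarrow>
   nat set \<Rightarrow> ('f, 'v, 'u, 'q, 'p) sen \<Rightarrow> bool"
where
  "sen_over A B \<Delta> X (PropS p) \<longleftrightarrow> p \<in> props \<Delta>"
| "sen_over A B \<Delta> X (AtS k \<gamma>) \<longleftrightarrow> At_op \<in> A \<and> vterm_over \<Delta> X k \<and> sen_over A B \<Delta> X \<gamma>"
| "sen_over A B \<Delta> X (AndS \<gamma> \<delta>) \<longleftrightarrow> And_op \<in> A \<and> sen_over A B \<Delta> X \<gamma> \<and> sen_over A B \<Delta> X \<delta>"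
| "sen_over A B \<Delta> X (NotS \<gamma>) \<longleftrightarrow> Not_op \<in> A \<and> sen_over A B \<Delta> X \<gamma>"
| "sen_over A B \<Delta> X (QNotS \<gamma>) \<longleftrightarrow> QNot_op \<in> A \<and> sen_over A B \<Delta> X \<gamma>"
| "sen_over A B \<Delta> X (BoxS a \<gamma>) \<longleftrightarrow> Box_op \<in> A \<and> action_over B \<Delta> a \<and> sen_over A B \<Delta> X \<gamma>"
| "sen_over A B \<Delta> X (StoreS z \<gamma>) \<longleftrightarrow> Store_op \<in> A \<and> sen_over A B \<Delta> (insert z X) \<gamma>"
| "sen_over A B \<Delta> X (ImpS \<gamma> \<delta>) \<longleftrightarrow> Imp_op \<in> A \<and> sen_over A B \<Delta> X \<gamma> \<and> sen_over A B \<Delta> X \<delta>"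
| "sen_over A B \<Delta> X (QImpS \<gamma> \<delta>) \<longleftrightarrow> QImp_op \<in> A \<and> closed_sen \<Delta> \<gamma> \<and> closed_sen \<Delta> \<delta> \<and>
     sen_over A B \<Delta> X \<gamma> \<and> sen_over A B \<Delta> X \<delta>"

text \<open>Substitution of a ground term for a variable; groundness rules out variable capture.\<close>

fun sterm_subst :: "nat \<Rightarrow> ('f, 'v, 'u, 'q) vterm \<Rightarrow> ('f, 'v, 'u, 'q) sterm \<Rightarrow> ('f, 'v, 'u, 'q) sterm"
  and vterm_subst :: "nat \<Rightarrow> ('f, 'v, 'u, 'q) vterm \<Rightarrow> ('f, 'v, 'u, 'q) vterm \<Rightarrow> ('f, 'v, 'u, 'q) vterm"
where
  "sterm_subst z k (SConst c) = SConst c"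
| "sterm_subst z k (SPlus s t) = SPlus (sterm_subst z k s) (sterm_subst z k t)"
| "sterm_subst z k (STimes s t) = STimes (sterm_subst z k s) (sterm_subst z k t)"
| "sterm_subst z k (SOp f ts) = SOp f (map (sterm_subst z k) ts)"
| "sterm_subst z k (SInner l m) = SInner (vterm_subst z k l) (vterm_subst z k m)"
| "vterm_subst z k (VConst d) = VConst d"
| "vterm_subst z k (VVar y) = (if y = z then k else VVar y)"
| "vterm_subst z k (VPlus l m) = VPlus (vterm_subst z k l) (vterm_subst z k m)"
| "vterm_subst z k (VScale s l) = VScale (sterm_subst z k s) (vterm_subst z k l)"
| "vterm_subst z k (VUnit u l) = VUnit u (vterm_subst z k l)"
| "vterm_subst z k (VMeas q l) = VMeas q (vterm_subst z k l)"

primrec sen_subst ::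
  "nat \<Rightarrow> ('f, 'v, 'u, 'q) vterm \<Rightarrow> ('f, 'v, 'u, 'q, 'p) sen \<Rightarrow> ('f, 'v, 'u, 'q, 'p) sen"
where
  "sen_subst z k (PropS p) = PropS p"
| "sen_subst z k (AtS l \<gamma>) = AtS (vterm_subst z k l) (sen_subst z k \<gamma>)"
| "sen_subst z k (AndS \<gamma> \<delta>) = AndS (sen_subst z k \<gamma>) (sen_subst z k \<delta>)"
| "sen_subst z k (NotS \<gamma>) = NotS (sen_subst z k \<gamma>)"
| "sen_subst z k (QNotS \<gamma>) = QNotS (sen_subst z k \<gamma>)"
| "sen_subst z k (BoxS a \<gamma>) = BoxS a (sen_subst z k \<gamma>)"
| "sen_subst z k (StoreS y \<gamma>) = StoreS y (if y = z then \<gamma> else sen_subst z k \<gamma>)"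
| "sen_subst z k (ImpS \<gamma> \<delta>) = ImpS (sen_subst z k \<gamma>) (sen_subst z k \<delta>)"
| "sen_subst z k (QImpS \<gamma> \<delta>) = QImpS (sen_subst z k \<gamma>) (sen_subst z k \<delta>)"

section \<open>Signature morphisms and translation\<close>

text \<open>
  Morphisms have no component on scalar constants, because those of the fragments considered are the
  identity on complex numbers.  An added vector constant may be sent to any constant symbol of sort
  vector, including the symbol \<open>0\<close>.
\<close>

record ('v, 'u, 'q, 'p) sig_mor =
  mor_unit :: "'u \<Rightarrow> 'u"
  mor_meas :: "'q \<Rightarrow> 'q"
  mor_vconst :: "'v \<Rightarrow> 'v vconst"
  mor_prop :: "'p \<Rightarrow> 'p"

primrec tr_vconst :: "('v, 'u, 'q, 'p) sig_mor \<Rightarrow> 'v vconst \<Rightarrow> 'v vconst"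
where
  "tr_vconst \<theta> Zero = Zero"
| "tr_vconst \<theta> (Name v) = mor_vconst \<theta> v"

fun tr_sterm :: "('v, 'u, 'q, 'p) sig_mor \<Rightarrow> ('f, 'v, 'u, 'q) sterm \<Rightarrow> ('f, 'v, 'u, 'q) sterm"
  and tr_vterm :: "('v, 'u, 'q, 'p) sig_mor \<Rightarrow> ('f, 'v, 'u, 'q) vterm \<Rightarrow> ('f, 'v, 'u, 'q) vterm"
where
  "tr_sterm \<theta> (SConst c) = SConst c"
| "tr_sterm \<theta> (SPlus s t) = SPlus (tr_sterm \<theta> s) (tr_sterm \<theta> t)"
| "tr_sterm \<theta> (STimes s t) = STimes (tr_sterm \<theta> s) (tr_sterm \<theta> t)"
| "tr_sterm \<theta> (SOp f ts) = SOp f (map (tr_sterm \<theta>) ts)"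
| "tr_sterm \<theta> (SInner k l) = SInner (tr_vterm \<theta> k) (tr_vterm \<theta> l)"
| "tr_vterm \<theta> (VConst d) = VConst (tr_vconst \<theta> d)"
| "tr_vterm \<theta> (VVar z) = VVar z"
| "tr_vterm \<theta> (VPlus k l) = VPlus (tr_vterm \<theta> k) (tr_vterm \<theta> l)"
| "tr_vterm \<theta> (VScale s k) = VScale (tr_sterm \<theta> s) (tr_vterm \<theta> k)"
| "tr_vterm \<theta> (VUnit u k) = VUnit (mor_unit \<theta> u) (tr_vterm \<theta> k)"
| "tr_vterm \<theta> (VMeas q k) = VMeas (mor_meas \<theta> q) (tr_vterm \<theta> k)"

fun tr_atom :: "('v, 'u, 'q, 'p) sig_mor \<Rightarrow> ('f, 'v, 'u, 'q) atom \<Rightarrow> ('f, 'v, 'u, 'q) atom"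
where
  "tr_atom \<theta> (EqS s t) = EqS (tr_sterm \<theta> s) (tr_sterm \<theta> t)"
| "tr_atom \<theta> (EqV k l) = EqV (tr_vterm \<theta> k) (tr_vterm \<theta> l)"
| "tr_atom \<theta> (LessS s t) = LessS (tr_sterm \<theta> s) (tr_sterm \<theta> t)"

primrec tr_sen :: "('v, 'u, 'q, 'p) sig_mor \<Rightarrow> ('f, 'v, 'u, 'q, 'p) sen \<Rightarrow> ('f, 'v, 'u, 'q, 'p) sen"
where
  "tr_sen \<theta> (PropS p) = PropS (mor_prop \<theta> p)"
| "tr_sen \<theta> (AtS k \<gamma>) = AtS (tr_vterm \<theta> k) (tr_sen \<theta> \<gamma>)"
| "tr_sen \<theta> (AndS \<gamma> \<delta>) = AndS (tr_sen \<theta> \<gamma>) (tr_sen \<theta> \<delta>)"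
| "tr_sen \<theta> (NotS \<gamma>) = NotS (tr_sen \<theta> \<gamma>)"
| "tr_sen \<theta> (QNotS \<gamma>) = QNotS (tr_sen \<theta> \<gamma>)"
| "tr_sen \<theta> (BoxS a \<gamma>) = BoxS (map_action (mor_unit \<theta>) (mor_meas \<theta>) a) (tr_sen \<theta> \<gamma>)"
| "tr_sen \<theta> (StoreS z \<gamma>) = StoreS z (tr_sen \<theta> \<gamma>)"
| "tr_sen \<theta> (ImpS \<gamma> \<delta>) = ImpS (tr_sen \<theta> \<gamma>) (tr_sen \<theta> \<delta>)"
| "tr_sen \<theta> (QImpS \<gamma> \<delta>) = QImpS (tr_sen \<theta> \<gamma>) (tr_sen \<theta> \<delta>)"

definition sig_morphism ::
  "('f::scalar_ops, 'v, 'u, 'q, 'p) hdql_sig \<Rightarrow> ('v, 'u, 'q, 'p) sig_mor \<Rightarrow>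
   ('f, 'v, 'u, 'q, 'p) hdql_sig \<Rightarrow> bool"
where
  "sig_morphism \<Delta>1 \<theta> \<Delta>2 \<longleftrightarrow>
     mor_unit \<theta> ` unitaries \<Delta>1 \<subseteq> unitaries \<Delta>2 \<and>
     mor_meas \<theta> ` measurements \<Delta>1 \<subseteq> measurements \<Delta>2 \<and>
     mor_vconst \<theta> ` vconsts \<Delta>1 \<subseteq> insert Zero (Name ` vconsts \<Delta>2) \<and>
     sconsts \<Delta>1 \<subseteq> sconsts \<Delta>2 \<and>
     mor_prop \<theta> ` props \<Delta>1 \<subseteq> props \<Delta>2 \<and>
     mor_prop \<theta> ` closed_props \<Delta>1 \<subseteq> closed_props \<Delta>2 \<and>
     (\<forall>a\<in>axms \<Delta>1. fo_entails \<Delta>2 (axms \<Delta>2) (tr_atom \<theta> a))"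

definition mor_id :: "('v, 'u, 'q, 'p) sig_mor"
  where "mor_id = \<lparr>mor_unit = id, mor_meas = id, mor_vconst = Name, mor_prop = id\<rparr>"

definition mor_comp ::
  "('v, 'u, 'q, 'p) sig_mor \<Rightarrow> ('v, 'u, 'q, 'p) sig_mor \<Rightarrow> ('v, 'u, 'q, 'p) sig_mor"
where
  "mor_comp \<theta>2 \<theta>1 =
     \<lparr>mor_unit = mor_unit \<theta>2 \<circ> mor_unit \<theta>1, mor_meas = mor_meas \<theta>2 \<circ> mor_meas \<theta>1,
      mor_vconst = tr_vconst \<theta>2 \<circ> mor_vconst \<theta>1, mor_prop = mor_prop \<theta>2 \<circ> mor_prop \<theta>1\<rparr>"

section \<open>Fragments and entailment systems\<close>

text \<open>
  A fragment restricts the category of signatures to a subcategory, full or not, and keeps some of the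
  operators.  Morphisms are represented by functions on whole types; values outside the source
  signature are irrelevant.
\<close>

record ('f, 'v, 'u, 'q, 'p) fragment =
  sigs :: "('f, 'v, 'u, 'q, 'p) hdql_sig set"
  mors :: "('f, 'v, 'u, 'q, 'p) hdql_sig \<Rightarrow> ('f, 'v, 'u, 'q, 'p) hdql_sig \<Rightarrow> ('v, 'u, 'q, 'p) sig_mor set"
  sen_ops :: "sen_operator set"
  act_ops :: "act_operator set"

definition hdql_fragment :: "('f::scalar_ops, 'v, 'u, 'q, 'p) fragment \<Rightarrow> bool"
where
  "hdql_fragment L \<longleftrightarrow>
     (\<forall>\<Delta>\<in>sigs L. diagram_sig \<Delta>) \<and>
     (\<forall>\<Delta>1\<in>sigs L. \<forall>\<Delta>2\<in>sigs L. \<forall>\<theta>\<in>mors L \<Delta>1 \<Delta>2. sig_morphism \<Delta>1 \<theta> \<Delta>2) \<and>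
     (\<forall>\<Delta>\<in>sigs L. mor_id \<in> mors L \<Delta> \<Delta>) \<and>
     (\<forall>\<Delta>1\<in>sigs L. \<forall>\<Delta>2\<in>sigs L. \<forall>\<Delta>3\<in>sigs L. \<forall>\<theta>1\<in>mors L \<Delta>1 \<Delta>2. \<forall>\<theta>2\<in>mors L \<Delta>2 \<Delta>3.
        mor_comp \<theta>2 \<theta>1 \<in> mors L \<Delta>1 \<Delta>3) \<and>
     (Imp_op \<in> sen_ops L \<or> QImp_op \<in> sen_ops L \<longrightarrow> At_op \<in> sen_ops L)"

definition sentences ::
  "('f::scalar_ops, 'v, 'u, 'q, 'p) fragment \<Rightarrow> ('f, 'v, 'u, 'q, 'p) hdql_sig \<Rightarrow>
   ('f, 'v, 'u, 'q, 'p) sen set"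
  where "sentences L \<Delta> = {\<gamma>. sen_over (sen_ops L) (act_ops L) \<Delta> {} \<gamma>}"

type_synonym ('f, 'v, 'u, 'q, 'p) entailment =
  "('f, 'v, 'u, 'q, 'p) hdql_sig \<Rightarrow> ('f, 'v, 'u, 'q) vterm \<Rightarrow>
   ('f, 'v, 'u, 'q, 'p) sen set \<Rightarrow> ('f, 'v, 'u, 'q, 'p) sen \<Rightarrow> bool"

text \<open>
  Here and in the rules below, \<open>R \<Delta> k \<Gamma> \<gamma>\<close> says that \<open>\<Gamma>\<close> entails \<open>\<gamma>\<close> at \<open>k\<close> over \<open>\<Delta>\<close>.  The first condition makes \<open>R\<close> a family
  of relations indexed by the signatures of \<open>L\<close> and their ground terms.
\<close>

definition entailment_system ::
  "('f::scalar_ops, 'v, 'u, 'q, 'p) fragment \<Rightarrow> ('f, 'v, 'u, 'q, 'p) entailment \<Rightarrow> bool"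
where
  "entailment_system L R \<longleftrightarrow>
     (\<forall>\<Delta> k \<Gamma> \<gamma>. R \<Delta> k \<Gamma> \<gamma> \<longrightarrow>
        \<Delta> \<in> sigs L \<and> ground_vterm \<Delta> k \<and> \<Gamma> \<subseteq> sentences L \<Delta> \<and> \<gamma> \<in> sentences L \<Delta>) \<and>
     (\<forall>\<Delta>\<in>sigs L. \<forall>k \<Gamma> \<gamma>. ground_vterm \<Delta> k \<and> \<Gamma> \<subseteq> sentences L \<Delta> \<and> \<gamma> \<in> \<Gamma> \<longrightarrow> R \<Delta> k \<Gamma> \<gamma>) \<and>
     (\<forall>\<Delta>\<in>sigs L. \<forall>k \<Gamma> \<Gamma>' \<gamma>. R \<Delta> k \<Gamma> \<gamma> \<and> \<Gamma>' \<subseteq> sentences L \<Delta> \<longrightarrow> R \<Delta> k (\<Gamma> \<union> \<Gamma>') \<gamma>) \<and>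
     (\<forall>\<Delta>1\<in>sigs L. \<forall>\<Delta>2\<in>sigs L. \<forall>\<theta>\<in>mors L \<Delta>1 \<Delta>2. \<forall>k \<Gamma> \<gamma>.
        R \<Delta>1 k \<Gamma> \<gamma> \<longrightarrow> R \<Delta>2 (tr_vterm \<theta> k) (tr_sen \<theta> ` \<Gamma>) (tr_sen \<theta> \<gamma>))"

definition closed_under_basic_rules ::
  "('f::scalar_ops, 'v, 'u, 'q, 'p) fragment \<Rightarrow> ('f, 'v, 'u, 'q, 'p) entailment \<Rightarrow> bool"
where
  "closed_under_basic_rules L R \<longleftrightarrow>
     (\<forall>\<Delta>\<in>sigs L. \<forall>\<Gamma>.
        (\<forall>k1 k2 \<gamma>. EqV k1 k2 \<in> axms \<Delta> \<and> R \<Delta> k1 \<Gamma> \<gamma> \<longrightarrow> R \<Delta> k2 \<Gamma> \<gamma>) \<and>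
        (\<forall>k1 k2 \<gamma>. AtS k1 \<gamma> \<in> sentences L \<Delta> \<and> ground_vterm \<Delta> k2 \<longrightarrow>
           (R \<Delta> k1 \<Gamma> \<gamma> \<longleftrightarrow> R \<Delta> k2 \<Gamma> (AtS k1 \<gamma>))) \<and>
        (\<forall>k z \<gamma>. StoreS z \<gamma> \<in> sentences L \<Delta> \<and> ground_vterm \<Delta> k \<longrightarrow>
           (R \<Delta> k \<Gamma> (sen_subst z k \<gamma>) \<longleftrightarrow> R \<Delta> k \<Gamma> (StoreS z \<gamma>))) \<and>
        (\<forall>k \<gamma>1 \<gamma>2. AndS \<gamma>1 \<gamma>2 \<in> sentences L \<Delta> \<longrightarrow>
           (R \<Delta> k \<Gamma> \<gamma>1 \<and> R \<Delta> k \<Gamma> \<gamma>2 \<longleftrightarrow> R \<Delta> k \<Gamma> (AndS \<gamma>1 \<gamma>2))))"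

text \<open>The rules for \<open>*\<close> are left out: these closure conditions are meant for fragments without \<open>*\<close>.\<close>

definition closed_under_necessity_rules ::
  "('f::scalar_ops, 'v, 'u, 'q, 'p) fragment \<Rightarrow> ('f, 'v, 'u, 'q, 'p) entailment \<Rightarrow> bool"
where
  "closed_under_necessity_rules L R \<longleftrightarrow>
     (\<forall>\<Delta>\<in>sigs L. \<forall>k \<Gamma>.
        (\<forall>u \<gamma>. BoxS (Unit u) \<gamma> \<in> sentences L \<Delta> \<longrightarrow>
           (R \<Delta> (VUnit u k) \<Gamma> \<gamma> \<longleftrightarrow> R \<Delta> k \<Gamma> (BoxS (Unit u) \<gamma>))) \<and>
        (\<forall>q \<gamma>. BoxS (Meas q) \<gamma> \<in> sentences L \<Delta> \<longrightarrow>
           (R \<Delta> (VMeas q k) \<Gamma> \<gamma> \<longleftrightarrow> R \<Delta> k \<Gamma> (BoxS (Meas q) \<gamma>))) \<and>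
        (\<forall>a1 a2 \<gamma>. BoxS (Seq a1 a2) \<gamma> \<in> sentences L \<Delta> \<longrightarrow>
           (R \<Delta> k \<Gamma> (BoxS (Seq a1 a2) \<gamma>) \<longleftrightarrow> R \<Delta> k \<Gamma> (BoxS a1 (BoxS a2 \<gamma>)))) \<and>
        (\<forall>a1 a2 \<gamma>. BoxS (Choice a1 a2) \<gamma> \<in> sentences L \<Delta> \<longrightarrow>
           (R \<Delta> k \<Gamma> (BoxS a1 \<gamma>) \<and> R \<Delta> k \<Gamma> (BoxS a2 \<gamma>) \<longleftrightarrow> R \<Delta> k \<Gamma> (BoxS (Choice a1 a2) \<gamma>))))"

definition closed_under_implication_rules ::
  "('f::scalar_ops, 'v, 'u, 'q, 'p) fragment \<Rightarrow> ('f, 'v, 'u, 'q, 'p) entailment \<Rightarrow> bool"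
where
  "closed_under_implication_rules L R \<longleftrightarrow>
     (\<forall>\<Delta>\<in>sigs L. \<forall>k \<Gamma>.
        (\<forall>\<phi> \<gamma>. ImpS \<phi> \<gamma> \<in> sentences L \<Delta> \<and> basic \<phi> \<longrightarrow>
           (R \<Delta> k \<Gamma> (ImpS \<phi> \<gamma>) \<and> R \<Delta> k \<Gamma> \<phi> \<longrightarrow> R \<Delta> k \<Gamma> \<gamma>) \<and>
           (R \<Delta> k (\<Gamma> \<union> {AtS k \<phi>}) \<gamma> \<longrightarrow> R \<Delta> k \<Gamma> (ImpS \<phi> \<gamma>))) \<and>
        (\<forall>\<rho>1 \<rho>2. QImpS \<rho>1 \<rho>2 \<in> sentences L \<Delta> \<and> closed_sen \<Delta> \<rho>1 \<and> basic \<rho>1 \<and>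
             closed_sen \<Delta> \<rho>2 \<and> quantum_clause \<Delta> \<rho>2 \<longrightarrow>
           (R \<Delta> k \<Gamma> (QImpS \<rho>1 \<rho>2) \<and> R \<Delta> k \<Gamma> \<rho>1 \<longrightarrow> R \<Delta> k \<Gamma> \<rho>2) \<and>
           (R \<Delta> k (\<Gamma> \<union> {AtS k \<rho>1}) \<rho>2 \<longrightarrow> R \<Delta> k \<Gamma> (QImpS \<rho>1 \<rho>2))))"

definition calculus ::
  "('f::scalar_ops, 'v, 'u, 'q, 'p) fragment \<Rightarrow> ('f, 'v, 'u, 'q, 'p) entailment \<Rightarrow> bool"
where
  "calculus L R \<longleftrightarrow>
     entailment_system L R \<and> closed_under_basic_rules L R \<and>
     closed_under_necessity_rules L R \<and> closed_under_implication_rules L R"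

text \<open>
  The least entailment system closed under the rules, as an intersection; by
  \<open>calculus_least_entailment\<close> below it is itself such a system.
\<close>

definition least_entailment ::
  "('f::scalar_ops, 'v, 'u, 'q, 'p) fragment \<Rightarrow> ('f, 'v, 'u, 'q, 'p) entailment"
  where "least_entailment L = (\<lambda>\<Delta> k \<Gamma> \<gamma>. \<forall>R. calculus L R \<longrightarrow> R \<Delta> k \<Gamma> \<gamma>)"

text \<open>
  The judgements of the intersection are well-formed because the relation of all well-formed judgements
  is a calculus.
\<close>

lemma over_mono:
  fixes s :: "('f::scalar_ops, 'v, 'u, 'q) sterm" and l :: "('f, 'v, 'u, 'q) vterm"
  shows "sterm_over S {} s \<Longrightarrow> sterm_over S X s" and "vterm_over S {} l \<Longrightarrow> vterm_over S X l"
  by (induction s and l) auto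

lemma subst_over:
  assumes "vterm_over S {} k"
  shows "sterm_over S (insert z X) s \<Longrightarrow> sterm_over S X (sterm_subst z k s)"
    and "vterm_over S (insert z X) l \<Longrightarrow> vterm_over S X (vterm_subst z k l)"
  using assms by (induction s and l) (auto intro: over_mono)

lemma sen_subst_closed: "closed_sen \<Delta> \<gamma> \<Longrightarrow> closed_sen \<Delta> (sen_subst z k \<gamma>)"
  by (induction \<gamma>) auto

lemma sen_over_subst:
  assumes "ground_vterm \<Delta> k"
  shows "sen_over A B \<Delta> (insert z X) \<gamma> \<Longrightarrow> sen_over A B \<Delta> X (sen_subst z k \<gamma>)"
  using assms
  by (induction \<gamma> arbitrary: X) (auto simp: insert_commute intro: subst_over sen_subst_closed)

lemma tr_over:
  fixes s :: "('f::scalar_ops, 'v, 'u, 'q) sterm" and l :: "('f, 'v, 'u, 'q) vterm"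
  assumes "sig_morphism \<Delta>1 \<theta> \<Delta>2"
  shows "sterm_over \<Delta>1 X s \<Longrightarrow> sterm_over \<Delta>2 X (tr_sterm \<theta> s)"
    and "vterm_over \<Delta>1 X l \<Longrightarrow> vterm_over \<Delta>2 X (tr_vterm \<theta> l)"
  using assms by (induction s and l) (auto simp: sig_morphism_def image_subset_iff)

lemma action_over_tr:
  assumes "sig_morphism \<Delta>1 \<theta> \<Delta>2"
  shows "action_over B \<Delta>1 a \<Longrightarrow> action_over B \<Delta>2 (map_action (mor_unit \<theta>) (mor_meas \<theta>) a)"
  using assms by (induction a) (auto simp: sig_morphism_def)

lemma meas_free_map: "meas_free a \<Longrightarrow> meas_free (map_action f g a)"
  by (induction a) auto

lemma closed_sen_tr:
  assumes "sig_morphism \<Delta>1 \<theta> \<Delta>2"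
  shows "closed_sen \<Delta>1 \<gamma> \<Longrightarrow> closed_sen \<Delta>2 (tr_sen \<theta> \<gamma>)"
  using assms by (induction \<gamma>) (auto simp: sig_morphism_def meas_free_map)

lemma sen_over_tr:
  assumes "sig_morphism \<Delta>1 \<theta> \<Delta>2"
  shows "sen_over A B \<Delta>1 X \<gamma> \<Longrightarrow> sen_over A B \<Delta>2 X (tr_sen \<theta> \<gamma>)"
  using assms
proof (induction \<gamma> arbitrary: X)
  case (PropS p)
  then show ?case by (auto simp: sig_morphism_def)
qed (auto simp: tr_over action_over_tr closed_sen_tr)

definition all_judgements :: "('f::scalar_ops, 'v, 'u, 'q, 'p) fragment \<Rightarrow> ('f, 'v, 'u, 'q, 'p) entailment"
  where "all_judgements L = (\<lambda>\<Delta> k \<Gamma> \<gamma>. \<Delta> \<in> sigs L \<and> ground_vterm \<Delta> k \<and> \<Gamma> \<subseteq> sentences L \<Delta> \<and> \<gamma> \<in> sentences L \<Delta>)"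

lemma axms_ground:
  fixes L :: "('a::scalar_ops, 'b, 'c, 'd, 'e) fragment"
  shows "hdql_fragment L \<Longrightarrow> \<Delta> \<in> sigs L \<Longrightarrow> EqV k1 k2 \<in> axms \<Delta> \<Longrightarrow> ground_vterm \<Delta> k1 \<and> ground_vterm \<Delta> k2"
proof -
  assume "hdql_fragment L" "\<Delta> \<in> sigs L" and e: "EqV k1 k2 \<in> axms \<Delta>"
  then obtain W where t: "fo_sig.truncate \<Delta> = diagram_fo_sig (unitaries \<Delta>) (measurements \<Delta>) W"
    and a: "axms \<Delta> = diagram_axms (unitaries \<Delta>) (measurements \<Delta>) W"
    by (auto simp: hdql_fragment_def diagram_sig_def)
  have tr: "sterm_over (fo_sig.truncate \<Delta>) X s = sterm_over \<Delta> X s"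
    "vterm_over (fo_sig.truncate \<Delta>) X l = vterm_over \<Delta> X l"
    for X and s :: "('a, 'b, 'c, 'd) sterm" and l :: "('a, 'b, 'c, 'd) vterm"
    by (induction s and l) (auto simp: fo_sig.truncate_def)
  show ?thesis using e a by (auto simp: diagram_axms_def simp flip: t tr)
qed

lemma calculus_all_judgements:
  assumes L: "hdql_fragment L"
  shows "calculus L (all_judgements L)"
proof -
  have "entailment_system L (all_judgements L)"
    using L unfolding entailment_system_def all_judgements_def hdql_fragment_def
    by (auto simp: sentences_def intro!: tr_over sen_over_tr)
  moreover have "closed_under_basic_rules L (all_judgements L)"
    using L axms_ground[OF L] unfolding closed_under_basic_rules_def all_judgements_def
    by (auto simp: sentences_def intro: sen_over_subst)
  moreover have "closed_under_necessity_rules L (all_judgements L)"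
    unfolding closed_under_necessity_rules_def all_judgements_def by (auto simp: sentences_def)
  moreover have "closed_under_implication_rules L (all_judgements L)"
    unfolding closed_under_implication_rules_def all_judgements_def by (auto simp: sentences_def)
  ultimately show ?thesis by (simp add: calculus_def)
qed

lemma calculus_least_entailment:
  assumes L: "hdql_fragment L"
  shows "calculus L (least_entailment L)"
proof -
  have I: "least_entailment L \<Delta> k \<Gamma> \<gamma>" if "\<And>R. calculus L R \<Longrightarrow> R \<Delta> k \<Gamma> \<gamma>" for \<Delta> k \<Gamma> \<gamma>
    unfolding least_entailment_def
  proof (intro allI impI)
    fix R assume "calculus L R"
    then show "R \<Delta> k \<Gamma> \<gamma>" by (fact that)
  qed
  have D: "R \<Delta> k \<Gamma> \<gamma>" if "least_entailment L \<Delta> k \<Gamma> \<gamma>" "calculus L R" for R \<Delta> k \<Gamma> \<gamma>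
    by (rule that(1)[unfolded least_entailment_def, rule_format, OF that(2)])
  have E: "entailment_system L R" and B: "closed_under_basic_rules L R"
    and N: "closed_under_necessity_rules L R" and P: "closed_under_implication_rules L R"
    if "calculus L R" for R
    using that unfolding calculus_def by blast+
  have "entailment_system L (least_entailment L)"
    unfolding entailment_system_def
  proof (intro conjI)
    show "\<forall>\<Delta> k \<Gamma> \<gamma>. least_entailment L \<Delta> k \<Gamma> \<gamma> \<longrightarrow>
        \<Delta> \<in> sigs L \<and> ground_vterm \<Delta> k \<and> \<Gamma> \<subseteq> sentences L \<Delta> \<and> \<gamma> \<in> sentences L \<Delta>"
      by (intro allI impI, drule D[OF _ calculus_all_judgements[OF L]])
        (simp add: all_judgements_def)
  qed (intro ballI allI impI I, (elim conjE)?, frule E, (drule (1) D)?,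
      unfold entailment_system_def, blast)+
  moreover have "closed_under_basic_rules L (least_entailment L)"
    unfolding closed_under_basic_rules_def
    by (intro ballI allI conjI impI iffI I; (elim conjE)?; frule B; ((drule (1) D)+)?;
        unfold closed_under_basic_rules_def; drule (1) bspec; blast)
  moreover have "closed_under_necessity_rules L (least_entailment L)"
    unfolding closed_under_necessity_rules_def
    by (intro ballI allI conjI impI iffI I; (elim conjE)?; frule N; ((drule (1) D)+)?;
        unfold closed_under_necessity_rules_def; drule (1) bspec; blast)
  moreover have "closed_under_implication_rules L (least_entailment L)"
    unfolding closed_under_implication_rules_def
    by (intro ballI allI conjI impI iffI I; (elim conjE)?; frule P; ((drule (1) D)+)?;
        unfold closed_under_implication_rules_def; drule (1) bspec; blast)
  ultimately show ?thesis by (simp add: calculus_def)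
qed

lemma least_entailment_le: "calculus L R \<Longrightarrow> least_entailment L \<le> R"
  by (auto simp: least_entailment_def le_fun_def)

end

(* Every rule has finitely many premises, so the judgements that are derivable from finitely many
   sentences are again closed under all the rules.  By leastness they are all the derivable judgements. *)
theory Submission
  imports Defs
begin

lemma entailment_system_union:
  assumes "entailment_system L R" and "\<Delta> \<in> sigs L" and "R \<Delta> k \<Gamma> \<gamma>" and "\<Gamma>' \<subseteq> sentences L \<Delta>"
  shows "R \<Delta> k (\<Gamma> \<union> \<Gamma>') \<gamma>"
  using assms(1)[unfolded entailment_system_def, THEN conjunct2, THEN conjunct2, THEN conjunct1]
    assms(2-4) by blast

text \<open>The condition on \<open>\<Gamma>\<close> is stated separately because a judgement of
  \<open>R\<close> about a finite subset says nothing about the remaining elements of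
  \<open>\<Gamma>\<close>, whereas an entailment system may relate only sets of sentences.\<close>

definition finite_part ::
  "('f::scalar_ops, 'v, 'u, 'q, 'p) fragment \<Rightarrow> ('f, 'v, 'u, 'q, 'p) entailment \<Rightarrow>
   ('f, 'v, 'u, 'q, 'p) entailment"
where
  "finite_part L R = (\<lambda>\<Delta> k \<Gamma> \<gamma>.
     \<Gamma> \<subseteq> sentences L \<Delta> \<and> (\<exists>\<Gamma>\<^sub>f\<subseteq>\<Gamma>. finite \<Gamma>\<^sub>f \<and> R \<Delta> k \<Gamma>\<^sub>f \<gamma>))"

lemma finite_partI:
  "\<Gamma> \<subseteq> sentences L \<Delta> \<Longrightarrow> \<Gamma>\<^sub>f \<subseteq> \<Gamma> \<Longrightarrow> finite \<Gamma>\<^sub>f \<Longrightarrow> R \<Delta> k \<Gamma>\<^sub>f \<gamma> \<Longrightarrow> finite_part L R \<Delta> k \<Gamma> \<gamma>"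
  unfolding finite_part_def by (intro conjI exI)

lemma finite_partE:
  assumes "finite_part L R \<Delta> k \<Gamma> \<gamma>"
  obtains \<Gamma>\<^sub>f where "\<Gamma> \<subseteq> sentences L \<Delta>" "\<Gamma>\<^sub>f \<subseteq> \<Gamma>" "finite \<Gamma>\<^sub>f" "R \<Delta> k \<Gamma>\<^sub>f \<gamma>"
  using assms unfolding finite_part_def by (elim conjE exE)

text \<open>Covers rules with one premise and an unchanged set of hypotheses: the finite set that
  yields the premise also yields the conclusion.\<close>

lemma finite_part_map:
  assumes "finite_part L R \<Delta> k \<Gamma> \<gamma>" and "\<And>\<Gamma>\<^sub>f. R \<Delta> k \<Gamma>\<^sub>f \<gamma> \<Longrightarrow> R \<Delta> k' \<Gamma>\<^sub>f \<gamma>'"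
  shows "finite_part L R \<Delta> k' \<Gamma> \<gamma>'"
  using assms(1) by (elim finite_partE) (rule finite_partI, assumption+, rule assms(2))

text \<open>The two premises of a rule may come with different finite sets. The Unions property
  weakens both to the union of these sets, which is still finite and contained in
  \<open>\<Gamma>\<close>, and the rule is applied there.\<close>

lemma finite_part_map2:
  assumes E: "entailment_system L R" and "\<Delta> \<in> sigs L"
    and "finite_part L R \<Delta> k1 \<Gamma> \<gamma>1" and "finite_part L R \<Delta> k2 \<Gamma> \<gamma>2"
    and rule: "\<And>\<Gamma>\<^sub>f. R \<Delta> k1 \<Gamma>\<^sub>f \<gamma>1 \<Longrightarrow> R \<Delta> k2 \<Gamma>\<^sub>f \<gamma>2 \<Longrightarrow> R \<Delta> k \<Gamma>\<^sub>f \<gamma>"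
  shows "finite_part L R \<Delta> k \<Gamma> \<gamma>"
proof -
  obtain \<Gamma>1 \<Gamma>2 where 1: "\<Gamma> \<subseteq> sentences L \<Delta>" "\<Gamma>1 \<subseteq> \<Gamma>" "finite \<Gamma>1" "R \<Delta> k1 \<Gamma>1 \<gamma>1"
    and 2: "\<Gamma>2 \<subseteq> \<Gamma>" "finite \<Gamma>2" "R \<Delta> k2 \<Gamma>2 \<gamma>2"
    using assms(3,4) by (elim finite_partE)
  have union: "R \<Delta> l (A \<union> B) \<delta>" if "R \<Delta> l A \<delta>" "B \<subseteq> \<Gamma>" for l A B \<delta>
    using entailment_system_union[OF E \<open>\<Delta> \<in> sigs L\<close> that(1)] 1(1) that(2) by blast
  have "R \<Delta> k (\<Gamma>1 \<union> \<Gamma>2) \<gamma>"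
  proof (rule rule)
    show "R \<Delta> k1 (\<Gamma>1 \<union> \<Gamma>2) \<gamma>1" using 1(4) 2(1) by (rule union)
    show "R \<Delta> k2 (\<Gamma>1 \<union> \<Gamma>2) \<gamma>2" using union[OF 2(3) 1(2)] by (simp add: Un_commute)
  qed
  with 1 2 show ?thesis by (intro finite_partI[of _ _ _ "\<Gamma>1 \<union> \<Gamma>2"]) auto
qed

lemma finite_part_iff:
  assumes "\<And>\<Gamma>\<^sub>f. R \<Delta> k \<Gamma>\<^sub>f \<gamma> \<longleftrightarrow> R \<Delta> k' \<Gamma>\<^sub>f \<gamma>'"
  shows "finite_part L R \<Delta> k \<Gamma> \<gamma> \<longleftrightarrow> finite_part L R \<Delta> k' \<Gamma> \<gamma>'"
  using assms by (simp add: finite_part_def)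

text \<open>Serves the rules for conjunction and for choice of actions. Introduction has to merge
  two finite sets, whereas each elimination keeps the set it is given.\<close>

lemma finite_part_conj_iff:
  assumes "entailment_system L R" and "\<Delta> \<in> sigs L"
    and "\<And>\<Gamma>\<^sub>f. R \<Delta> k1 \<Gamma>\<^sub>f \<gamma>1 \<and> R \<Delta> k2 \<Gamma>\<^sub>f \<gamma>2 \<longleftrightarrow> R \<Delta> k \<Gamma>\<^sub>f \<gamma>"
  shows "finite_part L R \<Delta> k1 \<Gamma> \<gamma>1 \<and> finite_part L R \<Delta> k2 \<Gamma> \<gamma>2 \<longleftrightarrow> finite_part L R \<Delta> k \<Gamma> \<gamma>"
proof
  assume "finite_part L R \<Delta> k1 \<Gamma> \<gamma>1 \<and> finite_part L R \<Delta> k2 \<Gamma> \<gamma>2"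
  then show "finite_part L R \<Delta> k \<Gamma> \<gamma>"
    by (elim conjE) (rule finite_part_map2[OF assms(1,2)], assumption+, simp flip: assms(3))
next
  assume fp: "finite_part L R \<Delta> k \<Gamma> \<gamma>"
  show "finite_part L R \<Delta> k1 \<Gamma> \<gamma>1 \<and> finite_part L R \<Delta> k2 \<Gamma> \<gamma>2"
    by (intro conjI finite_part_map[OF fp]) (simp_all flip: assms(3))
qed

text \<open>Covers the introduction rules for implications, which discharge the hypothesis
  \<open>\<delta>\<close>. Removing \<open>\<delta>\<close> from the finite set leaves a subset of
  \<open>\<Gamma>\<close>, whether or not \<open>\<delta>\<close> occurred in that set.\<close>

lemma finite_part_deduct:
  assumes E: "entailment_system L R" and "\<Delta> \<in> sigs L"
    and "finite_part L R \<Delta> k (\<Gamma> \<union> {\<delta>}) \<gamma>"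
    and rule: "\<And>\<Gamma>\<^sub>f. R \<Delta> k (\<Gamma>\<^sub>f \<union> {\<delta>}) \<gamma> \<Longrightarrow> R \<Delta> k \<Gamma>\<^sub>f \<gamma>'"
  shows "finite_part L R \<Delta> k \<Gamma> \<gamma>'"
proof -
  obtain \<Gamma>\<^sub>f where f: "\<Gamma> \<union> {\<delta>} \<subseteq> sentences L \<Delta>" "\<Gamma>\<^sub>f \<subseteq> \<Gamma> \<union> {\<delta>}" "finite \<Gamma>\<^sub>f" "R \<Delta> k \<Gamma>\<^sub>f \<gamma>"
    using assms(3) by (elim finite_partE)
  \<comment> \<open>The finite set may lack \<open>\<delta>\<close>, so it is added by weakening.
    That \<open>\<delta>\<close> is a sentence comes from the well-formedness condition inside
    \<open>finite_part\<close>.\<close>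
  have "R \<Delta> k (\<Gamma>\<^sub>f \<union> {\<delta>}) \<gamma>"
    using entailment_system_union[OF E \<open>\<Delta> \<in> sigs L\<close> f(4)] f(1) by blast
  \<comment> \<open>The rule fits because removing \<open>\<delta>\<close> and adding it again gives
    \<open>\<Gamma>\<^sub>f \<union> {\<delta>}\<close>.\<close>
  then have "R \<Delta> k (\<Gamma>\<^sub>f - {\<delta>}) \<gamma>'" by (intro rule) simp
  with f show ?thesis by (intro finite_partI[of _ _ _ "\<Gamma>\<^sub>f - {\<delta>}"]) auto
qed

text \<open>Each property has an evident finite witness: a singleton for Monotonicity, the given
  finite set for Unions, and its image for Translation.\<close>

lemma entailment_system_finite_part:
  assumes L: "hdql_fragment L" and E: "entailment_system L R"
  shows "entailment_system L (finite_part L R)"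
proof -
  note E = E[unfolded entailment_system_def]
  have mono: "finite_part L R \<Delta> k \<Gamma> \<gamma>"
    if "\<Delta> \<in> sigs L" "ground_vterm \<Delta> k" "\<Gamma> \<subseteq> sentences L \<Delta>" "\<gamma> \<in> \<Gamma>" for \<Delta> k \<Gamma> \<gamma>
  proof -
    have "{\<gamma>} \<subseteq> sentences L \<Delta>" "\<gamma> \<in> {\<gamma>}" using that by auto
    then have "R \<Delta> k {\<gamma>} \<gamma>" using E[THEN conjunct2, THEN conjunct1] that by blast
    with that show ?thesis by (intro finite_partI[of _ _ _ "{\<gamma>}"]) auto
  qed
  have tr: "finite_part L R \<Delta>2 (tr_vterm \<theta> k) (tr_sen \<theta> ` \<Gamma>) (tr_sen \<theta> \<gamma>)"
    if "\<Delta>1 \<in> sigs L" "\<Delta>2 \<in> sigs L" "\<theta> \<in> mors L \<Delta>1 \<Delta>2"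
      and fp: "finite_part L R \<Delta>1 k \<Gamma> \<gamma>"
    for \<Delta>1 \<Delta>2 \<theta> k \<Gamma> \<gamma>
  proof -
    obtain \<Gamma>\<^sub>f where f: "\<Gamma> \<subseteq> sentences L \<Delta>1" "\<Gamma>\<^sub>f \<subseteq> \<Gamma>" "finite \<Gamma>\<^sub>f" "R \<Delta>1 k \<Gamma>\<^sub>f \<gamma>"
      using fp by (elim finite_partE)
    \<comment> \<open>Translation for \<open>R\<close> concerns only the image of
      \<open>\<Gamma>\<^sub>f\<close>. That all of \<open>\<Gamma>\<close> is sent to sentences has
      to come from the fragment, whose morphisms are signature morphisms.\<close>
    have "sig_morphism \<Delta>1 \<theta> \<Delta>2" using L that by (auto simp: hdql_fragment_def)
    then have "tr_sen \<theta> ` \<Gamma> \<subseteq> sentences L \<Delta>2"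
      using f(1) by (auto simp: sentences_def intro: sen_over_tr)
    moreover have "R \<Delta>2 (tr_vterm \<theta> k) (tr_sen \<theta> ` \<Gamma>\<^sub>f) (tr_sen \<theta> \<gamma>)"
      using E[THEN conjunct2, THEN conjunct2, THEN conjunct2] that(1-3) f(4) by blast
    ultimately show ?thesis using f by (intro finite_partI[of _ _ _ "tr_sen \<theta> ` \<Gamma>\<^sub>f"]) auto
  qed
  have wf: "\<Delta> \<in> sigs L" "ground_vterm \<Delta> k" "\<Gamma> \<subseteq> sentences L \<Delta>" "\<gamma> \<in> sentences L \<Delta>"
    if fp: "finite_part L R \<Delta> k \<Gamma> \<gamma>" for \<Delta> k \<Gamma> \<gamma>
  proof -
    obtain \<Gamma>\<^sub>f where f: "\<Gamma> \<subseteq> sentences L \<Delta>" "R \<Delta> k \<Gamma>\<^sub>f \<gamma>"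
      using fp by (elim finite_partE)
    with E[THEN conjunct1, rule_format, of \<Delta> k \<Gamma>\<^sub>f \<gamma>]
    show "\<Delta> \<in> sigs L" "ground_vterm \<Delta> k" "\<Gamma> \<subseteq> sentences L \<Delta>" "\<gamma> \<in> sentences L \<Delta>"
      by simp_all
  qed
  have union: "finite_part L R \<Delta> k (\<Gamma> \<union> \<Gamma>') \<gamma>"
    if "finite_part L R \<Delta> k \<Gamma> \<gamma>" "\<Gamma>' \<subseteq> sentences L \<Delta>" for \<Delta> k \<Gamma> \<Gamma>' \<gamma>
    using that by (auto simp: finite_part_def)
  show ?thesis
    unfolding entailment_system_def
    by (intro conjI allI ballI impI; (elim conjE)?; rule wf mono union tr; assumption)
qed

text \<open>Apart from the introduction rules for the two implications, every rule has the same set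
  of hypotheses in its premises and its conclusion, so it transfers through the lemmas for one or
  two premises. The two exceptions go through \<open>finite_part_deduct\<close>.\<close>

lemma calculus_finite_part:
  fixes L :: "('f::scalar_ops, 'v, 'u, 'q, 'p) fragment"
  assumes L: "hdql_fragment L" and R: "calculus L R"
  shows "calculus L (finite_part L R)"
proof -
  have E: "entailment_system L R" and B: "closed_under_basic_rules L R"
    and N: "closed_under_necessity_rules L R" and P: "closed_under_implication_rules L R"
    using R unfolding calculus_def by blast+
  \<comment> \<open>The set of hypotheses is left schematic, so that the rules of \<open>R\<close>
    can be applied at the finite subsets instead of the \<open>\<Gamma>\<close> of the goal.\<close>
  note B = B[unfolded closed_under_basic_rules_def, THEN bspec, THEN spec]
    and N = N[unfolded closed_under_necessity_rules_def, THEN bspec, THEN spec, THEN spec]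
    and P = P[unfolded closed_under_implication_rules_def, THEN bspec, THEN spec, THEN spec]
  have "closed_under_basic_rules L (finite_part L R)"
    unfolding closed_under_basic_rules_def
  proof (intro ballI allI conjI impI; (elim conjE)?)
    fix \<Delta> \<Gamma> and k1 k2 :: "('f, 'v, 'u, 'q) vterm" and \<gamma> :: "('f, 'v, 'u, 'q, 'p) sen"
    assume "\<Delta> \<in> sigs L" and "EqV k1 k2 \<in> axms \<Delta>" and fp: "finite_part L R \<Delta> k1 \<Gamma> \<gamma>"
    then show "finite_part L R \<Delta> k2 \<Gamma> \<gamma>"
      using B[THEN conjunct1] by (intro finite_part_map[OF fp]) blast
  next
    fix \<Delta> \<Gamma> and k1 k2 :: "('f, 'v, 'u, 'q) vterm" and \<gamma> :: "('f, 'v, 'u, 'q, 'p) sen"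
    assume "\<Delta> \<in> sigs L" and "AtS k1 \<gamma> \<in> sentences L \<Delta>" and "ground_vterm \<Delta> k2"
    then show "finite_part L R \<Delta> k1 \<Gamma> \<gamma> \<longleftrightarrow> finite_part L R \<Delta> k2 \<Gamma> (AtS k1 \<gamma>)"
      by (intro finite_part_iff B[THEN conjunct2, THEN conjunct1, rule_format] conjI)
  next
    fix \<Delta> \<Gamma> z and k :: "('f, 'v, 'u, 'q) vterm" and \<gamma> :: "('f, 'v, 'u, 'q, 'p) sen"
    assume "\<Delta> \<in> sigs L" and "StoreS z \<gamma> \<in> sentences L \<Delta>" and "ground_vterm \<Delta> k"
    then show "finite_part L R \<Delta> k \<Gamma> (sen_subst z k \<gamma>) \<longleftrightarrow> finite_part L R \<Delta> k \<Gamma> (StoreS z \<gamma>)"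
      by (intro finite_part_iff B[THEN conjunct2, THEN conjunct2, THEN conjunct1, rule_format] conjI)
  next
    fix \<Delta> \<Gamma> k and \<gamma>1 \<gamma>2 :: "('f, 'v, 'u, 'q, 'p) sen"
    assume "\<Delta> \<in> sigs L" and "AndS \<gamma>1 \<gamma>2 \<in> sentences L \<Delta>"
    then show "finite_part L R \<Delta> k \<Gamma> \<gamma>1 \<and> finite_part L R \<Delta> k \<Gamma> \<gamma>2 \<longleftrightarrow>
        finite_part L R \<Delta> k \<Gamma> (AndS \<gamma>1 \<gamma>2)"
      by (intro finite_part_conj_iff[OF E]
          B[THEN conjunct2, THEN conjunct2, THEN conjunct2, rule_format])
  qed
  moreover have "closed_under_necessity_rules L (finite_part L R)"
    unfolding closed_under_necessity_rules_def
    \<comment> \<open>The equivalences for \<open>Unit\<close>, \<open>Meas\<close> and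
      \<open>Seq\<close> match \<open>finite_part_iff\<close>; the one for \<open>Choice\<close> has
      a conjunction on the left and matches \<open>finite_part_conj_iff\<close>.\<close>
    by (intro ballI allI conjI impI finite_part_iff finite_part_conj_iff[OF E]
        N[THEN conjunct1, rule_format] N[THEN conjunct2, THEN conjunct1, rule_format]
        N[THEN conjunct2, THEN conjunct2, THEN conjunct1, rule_format]
        N[THEN conjunct2, THEN conjunct2, THEN conjunct2, rule_format]; assumption)
  moreover have "closed_under_implication_rules L (finite_part L R)"
    unfolding closed_under_implication_rules_def
  proof (intro ballI allI conjI impI; elim conjE)
    fix \<Delta> k \<Gamma> \<phi> \<gamma>
    assume \<Delta>: "\<Delta> \<in> sigs L" and imp: "ImpS \<phi> \<gamma> \<in> sentences L \<Delta>" "basic \<phi>"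
    \<comment> \<open>\<open>\<Gamma>'\<close> stands for the merged finite set in modus ponens and
      for the finite set without the discharged hypothesis in the introduction rule.\<close>
    have rules: "R \<Delta> k' \<Gamma>' (ImpS \<phi> \<gamma>) \<Longrightarrow> R \<Delta> k' \<Gamma>' \<phi> \<Longrightarrow> R \<Delta> k' \<Gamma>' \<gamma>"
      "R \<Delta> k' (\<Gamma>' \<union> {AtS k' \<phi>}) \<gamma> \<Longrightarrow> R \<Delta> k' \<Gamma>' (ImpS \<phi> \<gamma>)" for k' \<Gamma>'
      using P[OF \<Delta>, THEN conjunct1, rule_format, of \<phi> \<gamma> k' \<Gamma>'] imp by blast+
    show "finite_part L R \<Delta> k \<Gamma> \<gamma>"
      if "finite_part L R \<Delta> k \<Gamma> (ImpS \<phi> \<gamma>)" "finite_part L R \<Delta> k \<Gamma> \<phi>"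
      using finite_part_map2[OF E \<Delta> that] rules by blast
    show "finite_part L R \<Delta> k \<Gamma> (ImpS \<phi> \<gamma>)"
      if "finite_part L R \<Delta> k (\<Gamma> \<union> {AtS k \<phi>}) \<gamma>"
      using finite_part_deduct[OF E \<Delta> that] rules by blast
  next
    fix \<Delta> k \<Gamma> \<rho>1 \<rho>2
    assume \<Delta>: "\<Delta> \<in> sigs L" and imp: "QImpS \<rho>1 \<rho>2 \<in> sentences L \<Delta>" "closed_sen \<Delta> \<rho>1"
      "basic \<rho>1" "closed_sen \<Delta> \<rho>2" "quantum_clause \<Delta> \<rho>2"
    have rules: "R \<Delta> k' \<Gamma>' (QImpS \<rho>1 \<rho>2) \<Longrightarrow> R \<Delta> k' \<Gamma>' \<rho>1 \<Longrightarrow> R \<Delta> k' \<Gamma>' \<rho>2"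
      "R \<Delta> k' (\<Gamma>' \<union> {AtS k' \<rho>1}) \<rho>2 \<Longrightarrow> R \<Delta> k' \<Gamma>' (QImpS \<rho>1 \<rho>2)" for k' \<Gamma>'
      using P[OF \<Delta>, THEN conjunct2, rule_format, of \<rho>1 \<rho>2 k' \<Gamma>'] imp by blast+
    show "finite_part L R \<Delta> k \<Gamma> \<rho>2"
      if "finite_part L R \<Delta> k \<Gamma> (QImpS \<rho>1 \<rho>2)" "finite_part L R \<Delta> k \<Gamma> \<rho>1"
      using finite_part_map2[OF E \<Delta> that] rules by blast
    show "finite_part L R \<Delta> k \<Gamma> (QImpS \<rho>1 \<rho>2)"
      if "finite_part L R \<Delta> k (\<Gamma> \<union> {AtS k \<rho>1}) \<rho>2"
      using finite_part_deduct[OF E \<Delta> that] rules by blast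
  qed
  ultimately show ?thesis
    using entailment_system_finite_part[OF L E] by (simp add: calculus_def)
qed

theorem proposition4p7:
  fixes L :: "('f::scalar_ops, 'v, 'u, 'q, 'p) fragment"
  assumes "hdql_fragment L"
    and no_closed_props: "\<forall>\<Delta>\<in>sigs L. closed_props \<Delta> = {}"
    and no_star: "Star_op \<notin> act_ops L"
  shows "\<forall>\<Delta>\<in>sigs L. \<forall>\<Gamma> \<gamma> k.
           \<Gamma> \<subseteq> sentences L \<Delta> \<and> \<gamma> \<in> sentences L \<Delta> \<and> ground_vterm \<Delta> k \<longrightarrow>
           least_entailment L \<Delta> k \<Gamma> \<gamma> \<longrightarrow>
           (\<exists>\<Gamma>\<^sub>f\<subseteq>\<Gamma>. finite \<Gamma>\<^sub>f \<and> least_entailment L \<Delta> k \<Gamma>\<^sub>f \<gamma>)"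
proof -
  \<comment> \<open>Leastness is applied to the finite part of the least system itself. This is a
    calculus because the intersection of all calculi is one.\<close>
  have "least_entailment L \<le> finite_part L (least_entailment L)"
    using assms(1) by (intro least_entailment_le calculus_finite_part calculus_least_entailment)
  then have "finite_part L (least_entailment L) \<Delta> k \<Gamma> \<gamma>" if "least_entailment L \<Delta> k \<Gamma> \<gamma>" for \<Delta> k \<Gamma> \<gamma>
    using that by (simp add: le_fun_def)
  then show ?thesis by (simp add: finite_part_def)
qed

end
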